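(* Let $Y$ be an invariant set and let $X$ be a finitely supported subset of $Y$ that is not FSM uniformly infinite. (1) Every finitely supported function $f:\wp_{us}(X)\to\wp_{us}(X)$ that is order-preserving with respect to inclusion has a least fixed point, and this least fixed point is supported by $supp(f)\cup supp(X)$. (2) Every finitely supported function $f:\wp_{fin}(X)\to\wp_{fin}(X)$ that is order-preserving with respect to inclusion has a least fixed point, and this least fixed point is supported by $supp(f)\cup supp(X)$.
   Context: Fix an infinite set $A$ of atoms. $S_A$ is the group of bijections of $A$ that are compositions of finitely many transpositions. An $S_A$-set is a set with a group action $\cdot$ of $S_A$. For $S\subseteq A$, $Fix(S)=\{\pi\in S_A:\pi(a)=a\ \forall a\in S\}$; $S$ supports $x$ if $\pi\cdot x=x$ for all $\pi\in Fix(S)$; the least finite supporting set of $x$ (when one exists) is $supp(x)$. An invariant set is an $S_A$-set all of whose elements have finite supporting sets. Powersets carry $\pi\star Z=\{\pi\cdot z:z\in Z\}$; $\wp_{fs}(Y)$ is the set of subsets of $Y$ finitely supported under $\star$ (invariant if $Y$ is); its elements are the finitely supported subsets of $Y$. Cartesian products carry the componentwise action. A set is uniformly supported if one finite $S\subseteq A$ supports all its elements. For $X\in\wp_{fs}(Y)$: $\wp_{us}(X)$ is the set of uniformly supported subsets of $X$ (including $\emptyset$) and $\wp_{fin}(X)$ the set of finite subsets of $X$; both are subsets of $\wp_{fs}(Y)$ supported by $supp(X)$. $X$ is FSM uniformly infinite if it has an infinite uniformly supported subset. A function $f:Z\to T$ between finitely supported subsets $Z,T$ of invariant sets $U,V$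 is finitely supported if its graph is a finitely supported subset of $U\times V$; equivalently, a finite $S$ supports $f$ iff for all $\pi\in Fix(S)$ and $x\in Z$: $\pi\cdot x\in Z$, $\pi\cdot f(x)\in T$ and $f(\pi\cdot x)=\pi\cdot f(x)$. $supp(f)$ is the least finite set supporting $f$. *)

theory Defs
  imports "HOL-Combinatorics.Permutations" "HOL-Algebra.Group_Action"
begin

(* The atoms are the elements of the type 'a; its infiniteness is a hypothesis of the theorem.
   The library predicate permutation says: a composition of finitely many transpositions. *)

definition SA :: "('a \<Rightarrow> 'a) monoid"
  where "SA = \<lparr>carrier = {\<pi>. permutation \<pi>}, mult = (\<circ>), one = id\<rparr>"

definition Fix :: "'a set \<Rightarrow> ('a \<Rightarrow> 'a) set"
  where "Fix S = {\<pi> \<in> carrier SA. \<forall>a\<in>S. \<pi> a = a}"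

definition supports :: "(('a \<Rightarrow> 'a) \<Rightarrow> 'y \<Rightarrow> 'y) \<Rightarrow> 'a set \<Rightarrow> 'y \<Rightarrow> bool"
  where "supports act S x \<longleftrightarrow> (\<forall>\<pi>\<in>Fix S. act \<pi> x = x)"

(* LEAST is with respect to inclusion; the value is unspecified if there is no least
   finite supporting set. *)
definition supp :: "(('a \<Rightarrow> 'a) \<Rightarrow> 'y \<Rightarrow> 'y) \<Rightarrow> 'y \<Rightarrow> 'a set"
  where "supp act x = (LEAST S. finite S \<and> supports act S x)"

(* An action is given by a total function of which only the values on the carrier Y matter.
   The library locale asks for functions that are undefined outside Y, hence restrict. *)
definition SA_set :: "'y set \<Rightarrow> (('a \<Rightarrow> 'a) \<Rightarrow> 'y \<Rightarrow> 'y) \<Rightarrow> bool"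
  where "SA_set Y act \<longleftrightarrow> group_action SA Y (\<lambda>\<pi>. restrict (act \<pi>) Y)"

definition invariant_set :: "'y set \<Rightarrow> (('a \<Rightarrow> 'a) \<Rightarrow> 'y \<Rightarrow> 'y) \<Rightarrow> bool"
  where "invariant_set Y act \<longleftrightarrow>
    SA_set Y act \<and> (\<forall>y\<in>Y. \<exists>S. finite S \<and> supports act S y)"

definition pow_act :: "(('a \<Rightarrow> 'a) \<Rightarrow> 'y \<Rightarrow> 'y) \<Rightarrow> ('a \<Rightarrow> 'a) \<Rightarrow> 'y set \<Rightarrow> 'y set"
  where "pow_act act \<pi> Z = act \<pi> ` Z"

definition prod_act :: "(('a \<Rightarrow> 'a) \<Rightarrow> 'u \<Rightarrow> 'u) \<Rightarrow> (('a \<Rightarrow> 'a) \<Rightarrow> 'v \<Rightarrow> 'v)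
    \<Rightarrow> ('a \<Rightarrow> 'a) \<Rightarrow> 'u \<times> 'v \<Rightarrow> 'u \<times> 'v"
  where "prod_act act1 act2 \<pi> = map_prod (act1 \<pi>) (act2 \<pi>)"

definition fs_Pow :: "(('a \<Rightarrow> 'a) \<Rightarrow> 'y \<Rightarrow> 'y) \<Rightarrow> 'y set \<Rightarrow> 'y set set"
  where "fs_Pow act Y = {Z. Z \<subseteq> Y \<and> (\<exists>S. finite S \<and> supports (pow_act act) S Z)}"

definition uniformly_supported :: "(('a \<Rightarrow> 'a) \<Rightarrow> 'y \<Rightarrow> 'y) \<Rightarrow> 'y set \<Rightarrow> bool"
  where "uniformly_supported act Z \<longleftrightarrow> (\<exists>S. finite S \<and> (\<forall>z\<in>Z. supports act S z))"

definition us_Pow :: "(('a \<Rightarrow> 'a) \<Rightarrow> 'y \<Rightarrow> 'y) \<Rightarrow> 'y set \<Rightarrow> 'y set set"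
  where "us_Pow act X = {Z. Z \<subseteq> X \<and> uniformly_supported act Z}"

definition uniformly_infinite :: "(('a \<Rightarrow> 'a) \<Rightarrow> 'y \<Rightarrow> 'y) \<Rightarrow> 'y set \<Rightarrow> bool"
  where "uniformly_infinite act X \<longleftrightarrow> (\<exists>Z\<subseteq>X. infinite Z \<and> uniformly_supported act Z)"

definition graph_on :: "'u set \<Rightarrow> ('u \<Rightarrow> 'v) \<Rightarrow> ('u \<times> 'v) set"
  where "graph_on Z f = {(x, f x) | x. x \<in> Z}"

(* Finitely supported functions from Z to T, where Z and T are subsets of the invariant sets
   U and V; the values of f outside Z are irrelevant. *)
definition fs_fun :: "(('a \<Rightarrow> 'a) \<Rightarrow> 'u \<Rightarrow> 'u) \<Rightarrow> 'u set \<Rightarrow> (('a \<Rightarrow> 'a) \<Rightarrow> 'v \<Rightarrow> 'v) \<Rightarrow> 'v set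
    \<Rightarrow> 'u set \<Rightarrow> 'v set \<Rightarrow> ('u \<Rightarrow> 'v) set"
  where "fs_fun actU U actV V Z T =
    {f \<in> Z \<rightarrow> T. graph_on Z f \<in> fs_Pow (prod_act actU actV) (U \<times> V)}"

definition fun_supp :: "(('a \<Rightarrow> 'a) \<Rightarrow> 'u \<Rightarrow> 'u) \<Rightarrow> (('a \<Rightarrow> 'a) \<Rightarrow> 'v \<Rightarrow> 'v)
    \<Rightarrow> 'u set \<Rightarrow> ('u \<Rightarrow> 'v) \<Rightarrow> 'a set"
  where "fun_supp actU actV Z f = supp (pow_act (prod_act actU actV)) (graph_on Z f)"

definition least_fixpoint_on :: "'y set set \<Rightarrow> ('y set \<Rightarrow> 'y set) \<Rightarrow> 'y set \<Rightarrow> bool"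
  where "least_fixpoint_on D f P \<longleftrightarrow>
    P \<in> D \<and> f P = P \<and> (\<forall>Q\<in>D. f Q = Q \<longrightarrow> P \<subseteq> Q)"

end

theory Submission
  imports Defs
begin

(* A uniformly supported subset of X is finite, and a finite set is uniformly supported, so both
   parts concern the finite subsets of X. The iterates of f at the empty set are supported by
   supp(f), and a finite set supported by S has only elements supported by S. Hence the union of the
   iterates is uniformly supported, thus finite, and the increasing sequence of iterates becomes
   stationary at the least fixed point. *)

section \<open>The group of finitary permutations and its actions\<close>

lemma carrier_SA_iff [simp]: "\<pi> \<in> carrier SA \<longleftrightarrow> permutation \<pi>"
  by (simp add: SA_def)

lemma mult_SA [simp]: "\<pi> \<otimes>\<^bsub>SA\<^esub> \<sigma> = \<pi> \<circ> \<sigma>"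
  by (simp add: SA_def)

lemma one_SA [simp]: "\<one>\<^bsub>SA\<^esub> = id"
  by (simp add: SA_def)

lemma group_SA: "group SA"
proof (rule groupI)
  fix \<pi> :: "'a \<Rightarrow> 'a" assume "\<pi> \<in> carrier SA"
  then have "permutation \<pi>" by simp
  then show "\<exists>\<sigma>\<in>carrier SA. \<sigma> \<otimes>\<^bsub>SA\<^esub> \<pi> = \<one>\<^bsub>SA\<^esub>"
    by (intro bexI[of _ "inv_into UNIV \<pi>"])
      (auto simp: permutation_inverse permutation_inverse_works)
qed (auto simp: o_assoc permutation_compose)

text \<open>Replaces the homomorphism into \<open>BijGroup Y\<close> and its \<open>restrict\<close>
  by equations that later proofs can rewrite with. Bijectivity is absent from the right-hand side
  because the inverse permutation acts as a two-sided inverse.\<close>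

lemma SA_set_iff:
  fixes act :: "('a \<Rightarrow> 'a) \<Rightarrow> 'y \<Rightarrow> 'y"
  shows "SA_set Y act \<longleftrightarrow>
    (\<forall>\<pi>. permutation \<pi> \<longrightarrow> (\<forall>y\<in>Y. act \<pi> y \<in> Y)) \<and>
    (\<forall>y\<in>Y. act id y = y) \<and>
    (\<forall>\<pi> \<sigma>. permutation \<pi> \<longrightarrow> permutation \<sigma> \<longrightarrow>
      (\<forall>y\<in>Y. act (\<pi> \<circ> \<sigma>) y = act \<pi> (act \<sigma> y)))"
  (is "?L \<longleftrightarrow> ?closed \<and> ?id \<and> ?comp")
proof
  let ?A = "\<lambda>\<pi> :: 'a \<Rightarrow> 'a. restrict (act \<pi>) Y"
  assume ?L
  then interpret group_action SA Y ?A by (simp add: SA_set_def)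
  have closed: "act \<pi> y \<in> Y" if "permutation \<pi>" "y \<in> Y" for \<pi> y
    using element_image[of \<pi> y] that by simp
  moreover have "act id y = y" if "y \<in> Y" for y
    using fun_cong[OF id_eq_one, of y] that by simp
  moreover have "act (\<pi> \<circ> \<sigma>) y = act \<pi> (act \<sigma> y)"
    if "permutation \<pi>" "permutation \<sigma>" "y \<in> Y" for \<pi> \<sigma> y
    using composition_rule[of y \<pi> \<sigma>] that closed by simp
  ultimately show "?closed \<and> ?id \<and> ?comp" by blast
next
  let ?A = "\<lambda>\<pi> :: 'a \<Rightarrow> 'a. restrict (act \<pi>) Y"
  assume R: "?closed \<and> ?id \<and> ?comp"
  have bij: "bij_betw (act \<pi>) Y Y" if p: "permutation \<pi>" for \<pi>
  proof (rule bij_betw_byWitness[where f' = "act (inv_into UNIV \<pi>)"])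
    have q: "permutation (inv_into UNIV \<pi>)" using p by (rule permutation_inverse)
    have "inv_into UNIV \<pi> \<circ> \<pi> = id" "\<pi> \<circ> inv_into UNIV \<pi> = id"
      using permutation_inverse_works[OF p] by auto
    then show "\<forall>y\<in>Y. act (inv_into UNIV \<pi>) (act \<pi> y) = y" "\<forall>y\<in>Y. act \<pi> (act (inv_into UNIV \<pi>) y) = y"
      using R p q by metis+
    show "act \<pi> ` Y \<subseteq> Y" "act (inv_into UNIV \<pi>) ` Y \<subseteq> Y" using R p q by auto
  qed
  have "?A \<in> hom SA (BijGroup Y)"
  proof (rule homI)
    fix \<pi> :: "'a \<Rightarrow> 'a" assume "\<pi> \<in> carrier SA"
    then show "?A \<pi> \<in> carrier (BijGroup Y)"
      using bij[of \<pi>] by (simp add: BijGroup_def Bij_def cong: bij_betw_cong)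
  next
    fix \<pi> \<sigma> :: "'a \<Rightarrow> 'a" assume "\<pi> \<in> carrier SA" "\<sigma> \<in> carrier SA"
    then show "?A (\<pi> \<otimes>\<^bsub>SA\<^esub> \<sigma>) = ?A \<pi> \<otimes>\<^bsub>BijGroup Y\<^esub> ?A \<sigma>"
      using bij[of \<pi>] bij[of \<sigma>] R
      by (auto simp: BijGroup_def Bij_def compose_def fun_eq_iff cong: bij_betw_cong)
  qed
  then show ?L
    by (simp add: SA_set_def group_action_def group_hom_def group_hom_axioms_def
        group_SA group_BijGroup)
qed

lemma SA_set_Pow: "SA_set Y act \<Longrightarrow> SA_set (Pow Y) (pow_act act)"
  unfolding SA_set_iff pow_act_def
  by (auto simp: image_image subset_iff intro!: image_cong)

lemma SA_set_Times:
  "SA_set U actU \<Longrightarrow> SA_set V actV \<Longrightarrow> SA_set (U \<times> V) (prod_act actU actV)"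
  unfolding SA_set_iff prod_act_def by auto

section \<open>Supports and the least support\<close>

lemma Fix_iff: "\<pi> \<in> Fix S \<longleftrightarrow> permutation \<pi> \<and> (\<forall>a\<in>S. \<pi> a = a)"
  by (simp add: Fix_def)

lemma supports_mono: "supports act S x \<Longrightarrow> S \<subseteq> T \<Longrightarrow> supports act T x"
  by (simp add: supports_def Fix_iff subset_iff)

lemma transpose_in_Fix: "a \<notin> S \<Longrightarrow> b \<notin> S \<Longrightarrow> transpose a b \<in> Fix S"
  by (auto simp: Fix_iff permutation_swap_id transpose_def)

lemma supports_transpose:
  "supports act S x \<Longrightarrow> a \<notin> S \<Longrightarrow> b \<notin> S \<Longrightarrow> act (transpose a b) x = x"
  by (simp add: supports_def transpose_in_Fix)

text \<open>A permutation in \<open>Fix S\<close> moves only finitely many atoms, all outside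
  \<open>S\<close>, so it is a product of transpositions of such atoms.\<close>

lemma supports_transposeI:
  assumes Y: "SA_set Y act" "x \<in> Y"
    and *: "\<And>a b. a \<notin> S \<Longrightarrow> b \<notin> S \<Longrightarrow> act (transpose a b) x = x"
  shows "supports act S x"
  unfolding supports_def
proof
  fix \<pi> assume "\<pi> \<in> Fix S"
  then have \<pi>: "permutation \<pi>" "\<And>a. a \<in> S \<Longrightarrow> \<pi> a = a" by (auto simp: Fix_iff)
  define M where "M = {a. \<pi> a \<noteq> a}"
  have M: "a \<notin> S" if "a \<in> M" for a using \<pi>(2) that by (auto simp: M_def)
  have "finite M" using \<pi>(1) by (simp add: M_def permutation)
  have "\<pi> permutes M"
    using \<pi>(1) by (simp add: M_def permutes_def permutation bij_iff)
  \<comment> \<open>\<open>permutation\<close> is carried through the induction because the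
    composition law in \<open>SA_set_iff\<close> applies to such maps only.\<close>
  then have "permutation \<pi> \<and> act \<pi> x = x"
    using \<open>finite M\<close>
  proof (induction rule: permutes_induct)
    case id
    then show ?case using Y permutation_id unfolding SA_set_iff by blast
  next
    case (swap a b p)
    then have "a \<notin> S" "b \<notin> S" using M by auto
    then have "act (transpose a b \<circ> p) x = x"
      using swap * Y by (simp add: SA_set_iff permutation_swap_id del: comp_apply)
    then show ?case
      using swap by (simp only: permutation_compose permutation_swap_id simp_thms)
  qed
  then show "act \<pi> x = x" ..
qed

text \<open>The source of least supports. A swap of an atom of \<open>S - T\<close> with one of
  \<open>T - S\<close> fixes neither set pointwise; an atom outside both, available since there are
  infinitely many atoms, mediates.\<close>

lemma supports_Int:
  fixes act :: "('a \<Rightarrow> 'a) \<Rightarrow> 'y \<Rightarrow> 'y"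
  assumes inf: "infinite (UNIV :: 'a set)" and Y: "SA_set Y act" "x \<in> Y"
    and fin: "finite S" "finite T" and sup: "supports act S x" "supports act T x"
  shows "supports act (S \<inter> T) x"
proof (rule supports_transposeI[OF Y])
  fix a b assume a: "a \<notin> S \<inter> T" and b: "b \<notin> S \<inter> T"
  obtain c where c: "c \<notin> S \<union> T \<union> {a, b}"
    using ex_new_if_finite[OF inf, of "S \<union> T \<union> {a, b}"] fin by auto
  have ac: "act (transpose a c) x = x"
    using supports_transpose[of act S x a c] supports_transpose[of act T x a c] sup a c
    by blast
  have bc: "act (transpose b c) x = x"
    using supports_transpose[of act S x b c] supports_transpose[of act T x b c] sup b c
    by blast
  (* (a b) = (a c) (b c) (a c), and each factor fixes S or T pointwise *)
  show "act (transpose a b) x = x"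
  proof (cases "a = b")
    case True
    then show ?thesis using Y by (simp add: SA_set_iff)
  next
    case False
    then have "transpose a b = transpose a c \<circ> (transpose b c \<circ> transpose a c)"
      using c by (auto simp: fun_eq_iff transpose_def)
    then show ?thesis
      using Y ac bc by (simp add: SA_set_iff permutation_compose permutation_swap_id)
  qed
qed

text \<open>A finite supporting set of minimal cardinality is least: its intersection with any other
  one supports \<open>x\<close> again, so it cannot be smaller. Thus the \<open>LEAST\<close> in
  \<open>supp\<close> denotes a genuine least set.\<close>

lemma supp_is_least:
  fixes act :: "('a \<Rightarrow> 'a) \<Rightarrow> 'y \<Rightarrow> 'y"
  assumes inf: "infinite (UNIV :: 'a set)" and Y: "SA_set Y act" "x \<in> Y"
    and ex: "\<exists>S. finite S \<and> supports act S x"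
  shows "finite (supp act x)" and "supports act (supp act x) x"
    and "\<And>T. finite T \<Longrightarrow> supports act T x \<Longrightarrow> supp act x \<subseteq> T"
proof -
  obtain S where S: "finite S" "supports act S x"
    and min: "\<And>T. finite T \<and> supports act T x \<Longrightarrow> card S \<le> card T"
    using ex_has_least_nat[of "\<lambda>S. finite S \<and> supports act S x" _ card] ex by blast
  have least: "S \<subseteq> T" if T: "finite T" "supports act T x" for T
  proof -
    have "card S \<le> card (S \<inter> T)"
      using min supports_Int[OF inf Y S(1) T(1) S(2) T(2)] S by blast
    then have "S \<inter> T = S" using S(1) by (intro card_seteq) auto
    then show ?thesis by blast
  qed
  then have "supp act x = S"
    unfolding supp_def using S by (intro Least_equality) auto
  then show "finite (supp act x)" "supports act (supp act x) x"
    "\<And>T. finite T \<Longrightarrow> supports act T x \<Longrightarrow> supp act x \<subseteq> T"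
    using S least by auto
qed

section \<open>From supports of finite sets to supports of their elements\<close>

lemma supports_act_image:
  assumes Y: "SA_set Y act" "x \<in> Y" and \<pi>: "permutation \<pi>" and S: "supports act S x"
  shows "supports act (\<pi> ` S) (act \<pi> x)"
  unfolding supports_def
proof
  fix \<sigma> assume \<sigma>: "\<sigma> \<in> Fix (\<pi> ` S)"
  let ?\<tau> = "inv_into UNIV \<pi> \<circ> (\<sigma> \<circ> \<pi>)"
  have \<tau>: "permutation ?\<tau>"
    using \<pi> \<sigma> by (auto simp: Fix_iff intro!: permutation_compose permutation_inverse)
  have "\<pi> \<circ> ?\<tau> = \<sigma> \<circ> \<pi>"
    using permutation_inverse_works[OF \<pi>] by (simp add: o_assoc)
  moreover have "?\<tau> \<in> Fix S"
    using \<tau> \<sigma> permutation_inverse_works[OF \<pi>] by (auto simp: Fix_iff fun_eq_iff)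
  ultimately show "act \<sigma> (act \<pi> x) = act \<pi> x"
    using S Y \<pi> \<sigma> \<tau> unfolding supports_def SA_set_iff by (metis Fix_iff)
qed

(* If a is in supp(z) but not in S, then all (a b) z with b fresh lie in the finite set Z, so
   (a b) z = (a c) z for some b \<noteq> c. Then z = (a b) (a c) z is supported by the image of supp(z)
   under (a b) (a c), which does not contain a. *)
lemma supports_finite_set_imp_supports_elem:
  fixes act :: "('a \<Rightarrow> 'a) \<Rightarrow> 'y \<Rightarrow> 'y"
  assumes inf: "infinite (UNIV :: 'a set)" and Y: "invariant_set Y act"
    and Z: "finite Z" "Z \<subseteq> Y" "z \<in> Z"
    and S: "finite S" "supports (pow_act act) S Z"
  shows "supports act S z"
proof -
  have SA: "SA_set Y act" and z: "z \<in> Y" using Y Z by (auto simp: invariant_set_def)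
  define T where "T = supp act z"
  have "\<exists>S. finite S \<and> supports act S z" using Y z by (auto simp: invariant_set_def)
  note T = supp_is_least[OF inf SA z this, folded T_def]
  have "T \<subseteq> S"
  proof (rule ccontr)
    assume "\<not> T \<subseteq> S"
    then obtain a where a: "a \<in> T" "a \<notin> S" by blast
    let ?B = "- (S \<union> T)"
    have "infinite ?B"
      using inf S(1) T(1) by (metis finite_Un finite_compl)
    moreover have "(\<lambda>b. act (transpose a b) z) ` ?B \<subseteq> Z"
    proof
      fix y assume "y \<in> (\<lambda>b. act (transpose a b) z) ` ?B"
      then obtain b where b: "b \<notin> S" "y = act (transpose a b) z" by auto
      \<comment> \<open>Both \<open>a\<close> and \<open>b\<close> lie outside \<open>S\<close>, so
        their swap maps \<open>Z\<close> onto itself.\<close>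
      have "act (transpose a b) ` Z = Z"
        using supports_transpose[OF S(2) a(2) b(1)] by (simp add: pow_act_def)
      then show "y \<in> Z" using Z b by blast
    qed
    ultimately have "\<not> inj_on (\<lambda>b. act (transpose a b) z) ?B"
      using Z(1) finite_subset finite_imageD by blast
    then obtain b c where bc: "b \<noteq> c" "b \<notin> T" "c \<notin> T"
      and eq: "act (transpose a b) z = act (transpose a c) z"
      by (auto simp: inj_on_def)
    have z': "act (transpose a c) z \<in> Y" using SA z by (simp add: SA_set_iff permutation_swap_id)
    have "act (transpose a b) (act (transpose a b) z) = act (transpose a b \<circ> transpose a b) z"
      using SA z by (simp add: SA_set_iff permutation_swap_id del: transpose_comp_involutory)
    also have "\<dots> = z" using SA z by (simp add: SA_set_iff)
    finally have zback: "act (transpose a b) (act (transpose a c) z) = z" using eq by simp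
    have "supports act (transpose a c ` T) (act (transpose a c) z)"
      by (rule supports_act_image[OF SA z permutation_swap_id T(2)])
    from supports_act_image[OF SA z' permutation_swap_id this, of a b]
    have "supports act (transpose a b ` transpose a c ` T) z"
      by (simp only: zback)
    then have "T \<subseteq> transpose a b ` transpose a c ` T" using T by simp
    then obtain t where "t \<in> T" "a = transpose a b (transpose a c t)" using a by blast
    \<comment> \<open>Undoing the swaps sends \<open>a\<close> first to \<open>b\<close>, and then
      \<open>transpose a c\<close> leaves \<open>b\<close> alone, since \<open>b\<close> differs
      from \<open>c\<close> and, lying outside \<open>T\<close>, from \<open>a\<close>.\<close>
    then have "t = b"
      using bc a by (metis transpose_apply_first transpose_apply_second
          transpose_involutory transpose_apply_other)
    then show False using \<open>t \<in> T\<close> bc by simp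
  qed
  then show ?thesis by (rule supports_mono[OF T(2)])
qed

section \<open>Finite subsets and least fixed points\<close>

lemma finite_imp_uniformly_supported:
  assumes "invariant_set Y act" "Z \<subseteq> Y" "finite Z"
  shows "uniformly_supported act Z"
proof -
  obtain s where "\<And>y. y \<in> Y \<Longrightarrow> finite (s y) \<and> supports act (s y) y"
    using assms(1) unfolding invariant_set_def by metis
  then show ?thesis
    unfolding uniformly_supported_def using assms
    by (intro exI[of _ "\<Union>(s ` Z)"]) (auto intro: supports_mono)
qed

lemma us_Pow_eq_Fpow:
  assumes "invariant_set Y act" "X \<subseteq> Y" "\<not> uniformly_infinite act X"
  shows "us_Pow act X = Fpow X"
  using assms finite_imp_uniformly_supported[OF assms(1)]
  unfolding us_Pow_def Fpow_def uniformly_infinite_def by blast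

text \<open>Acting on a point of the graph gives a point of the graph, and there the first
  coordinate determines the second.\<close>

lemma graph_supported_imp_equivariant:
  assumes "supports (pow_act (prod_act actU actV)) S (graph_on Z f)" "\<pi> \<in> Fix S" "x \<in> Z"
  shows "f (actU \<pi> x) = actV \<pi> (f x)"
proof -
  have "(x, f x) \<in> graph_on Z f" using assms(3) by (auto simp: graph_on_def)
  then have "prod_act actU actV \<pi> (x, f x) \<in> graph_on Z f"
    using assms(1,2) unfolding supports_def pow_act_def by blast
  then show ?thesis by (auto simp: graph_on_def prod_act_def)
qed

lemma Fpow_least_fixpoint:
  fixes act :: "('a \<Rightarrow> 'a) \<Rightarrow> 'y \<Rightarrow> 'y"
  assumes inf: "infinite (UNIV :: 'a set)" and Y: "invariant_set Y act"
    and X: "X \<subseteq> Y" and nui: "\<not> uniformly_infinite act X"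
    and f: "f \<in> Fpow X \<rightarrow> Fpow X" and mono: "mono_on (Fpow X) f"
    and S: "finite S" "supports (pow_act (prod_act (pow_act act) (pow_act act))) S (graph_on (Fpow X) f)"
  shows "\<exists>P. least_fixpoint_on (Fpow X) f P \<and> supports (pow_act act) S P"
proof -
  let ?F = "\<lambda>n. (f ^^ n) {}"
  have F: "?F n \<in> Fpow X" for n
    using f by (induction n) (auto simp: Fpow_def)
  have supF: "supports (pow_act act) S (?F n)" for n
  proof (induction n)
    case 0
    then show ?case by (simp add: supports_def pow_act_def)
  next
    case (Suc n)
    \<comment> \<open>A permutation in \<open>Fix S\<close> commutes with \<open>f\<close> and fixes
      \<open>?F n\<close>, hence fixes \<open>f (?F n)\<close>.\<close>
    then show ?case
      using graph_supported_imp_equivariant[OF S(2) _ F[of n]] by (simp add: supports_def)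
  qed
  have "supports act S z" if "z \<in> (\<Union>n. ?F n)" for z
  proof -
    from that obtain n where z: "z \<in> ?F n" by blast
    have "finite (?F n)" "?F n \<subseteq> Y" using F[of n] X by (auto simp: Fpow_def)
    from supports_finite_set_imp_supports_elem[OF inf Y this z S(1) supF]
    show ?thesis .
  qed
  then have "uniformly_supported act (\<Union>n. ?F n)"
    using S(1) unfolding uniformly_supported_def by blast
  moreover have "(\<Union>n. ?F n) \<subseteq> X" using F by (auto simp: Fpow_def)
  ultimately have "finite (\<Union>n. ?F n)"
    using nui unfolding uniformly_infinite_def by blast
  \<comment> \<open>All iterates are subsets of one finite set, so only finitely many are
    distinct.\<close>
  then have fin: "finite (range ?F)"
    by (rule finite_UnionD)
  have inc: "?F n \<subseteq> ?F (Suc n)" for n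
  proof (induction n)
    case (Suc n)
    then show ?case using monotone_onD[OF mono F F, of n "Suc n"] by simp
  qed simp
  \<comment> \<open>An inclusion-maximal iterate. As \<open>?F m \<subseteq> ?F (Suc m)\<close>,
    maximality forces equality, which is the fixed point equation.\<close>
  obtain m where m: "\<And>n. ?F m \<subseteq> ?F n \<Longrightarrow> ?F m = ?F n"
    using finite_has_maximal[OF fin] by (auto simp: image_iff)
  have "f (?F m) = ?F m" using m[OF inc] by simp
  \<comment> \<open>Every fixed point bounds all iterates, as it contains the empty set and
    \<open>f\<close> is monotone.\<close>
  moreover have "?F n \<subseteq> Q" if Q: "Q \<in> Fpow X" "f Q = Q" for n Q
  proof (induction n)
    case (Suc n)
    then show ?case using monotone_onD[OF mono F Q(1), of n] Q(2) by simp
  qed simp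
  ultimately have "least_fixpoint_on (Fpow X) f (?F m)"
    using F by (simp add: least_fixpoint_on_def)
  then show ?thesis using supF by blast
qed

theorem theorem3p4:
  fixes act :: "('a \<Rightarrow> 'a) \<Rightarrow> 'y \<Rightarrow> 'y" and Y X :: "'y set"
  assumes "infinite (UNIV :: 'a set)"
    and "invariant_set Y act"
    and "X \<in> fs_Pow act Y"
    and "\<not> uniformly_infinite act X"
  shows
    "(\<forall>f \<in> fs_fun (pow_act act) (fs_Pow act Y) (pow_act act) (fs_Pow act Y)
              (us_Pow act X) (us_Pow act X).
        mono_on (us_Pow act X) f \<longrightarrow>
        (\<exists>P. least_fixpoint_on (us_Pow act X) f P \<and>
             supports (pow_act act)
               (fun_supp (pow_act act) (pow_act act) (us_Pow act X) f \<union> supp (pow_act act) X) P))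
     \<and>
     (\<forall>f \<in> fs_fun (pow_act act) (fs_Pow act Y) (pow_act act) (fs_Pow act Y)
              (Fpow X) (Fpow X).
        mono_on (Fpow X) f \<longrightarrow>
        (\<exists>P. least_fixpoint_on (Fpow X) f P \<and>
             supports (pow_act act)
               (fun_supp (pow_act act) (pow_act act) (Fpow X) f \<union> supp (pow_act act) X) P))"
proof -
  have X: "X \<subseteq> Y" and SA: "SA_set Y act"
    using assms(2,3) by (auto simp: fs_Pow_def invariant_set_def)
  let ?P = "pow_act act" and ?G = "pow_act (prod_act (pow_act act) (pow_act act))"
  \<comment> \<open>The graph is placed in full powersets, whose action comes directly from that on
    \<open>Y\<close>; \<open>supp_is_least\<close> then asks only for one finite set supporting the
    graph.\<close>
  have SAG: "SA_set (Pow (Pow Y \<times> Pow Y)) ?G"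
    by (intro SA_set_Pow SA_set_Times SA)
  have "\<exists>P. least_fixpoint_on (Fpow X) f P \<and>
      supports ?P (fun_supp ?P ?P (Fpow X) f \<union> supp ?P X) P"
    if f: "f \<in> fs_fun ?P (fs_Pow act Y) ?P (fs_Pow act Y) (Fpow X) (Fpow X)"
      and mono: "mono_on (Fpow X) f" for f
  proof -
    have maps: "f \<in> Fpow X \<rightarrow> Fpow X"
      and graph: "graph_on (Fpow X) f \<in> Pow (Pow Y \<times> Pow Y)"
      and ex: "\<exists>S. finite S \<and> supports ?G S (graph_on (Fpow X) f)"
      using f by (auto simp: fs_fun_def fs_Pow_def)
    note least = supp_is_least[OF assms(1) SAG graph ex]
    show ?thesis
      \<comment> \<open>\<open>S\<close> is taken to be the least support of the graph, and the
        resulting support of \<open>P\<close> is then enlarged to the union.\<close>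
      using Fpow_least_fixpoint[OF assms(1,2) X assms(4) maps mono least(1,2)]
      unfolding fun_supp_def by (meson supports_mono Un_upper1)
  qed
  then show ?thesis
    unfolding us_Pow_eq_Fpow[OF assms(2) X assms(4)] by blast
qed

end
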